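(* Let $Z=\mathbb{R}^K\times\mathbb{R}$, let $\mathcal{P}$ be a statistical model on $Z^{\infty}$ equipped with an ATTS sequence of statistics $(S_n)$, and let $\mathcal{N}$ be a set of positive integers. Suppose the statistics $S_n$ are boundedly complete (with respect to $\mathcal{P}$) for all $n\in\mathcal{N}$. If a confidence predictor $\Gamma$ is invariant and weakly valid for $n\in\mathcal{N}$, then there is a conformal predictor that is at least as accurate as $\Gamma$ for $n\in\mathcal{N}$.
   Context: $K$ is the fixed number of explanatory variables; observations are $\zeta_i=(\mathbf{x}_i,y_i)\in Z=\mathbb{R}^K\times\mathbb{R}$. A statistical model $\mathcal{P}$ on $Z^{\infty}$ is a set of probability distributions on $Z^{\infty}$. Statistics $S_n:Z^n\to\Sigma_n$, $n=1,2,\ldots$, are measurable maps into measurable spaces with $\Sigma_n=S_n(Z^n)$; $\Sigma_0$ is a fixed one-element set (and $S_0$ is the constant with value in $\Sigma_0$). The sequence $(S_n)$ is algebraically transitive if there exist measurable functions $F_n:\Sigma_{n-1}\times Z\to\Sigma_n$, $n=2,3,\ldots$, such that $S_n(\zeta_1,\ldots,\zeta_n)=F_n(S_{n-1}(\zeta_1,\ldots,\zeta_{n-1}),\zeta_n)$ for all $(\zeta_1,\ldots,\zeta_n)\in Z^n$. The sequence $(S_n)$ is totally sufficient for $\mathcal{P}$ if, for each $n=1,2,\ldots$: (i) $S_n$ is sufficient for $\mathcal{P}$, i.e., there is a regular conditional distribution of $(\zeta_1,\ldots,\zeta_n)$ given $S_n(\zeta_1,\ldots,\zeta_n)$ that is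 the same for all $P\in\mathcal{P}$; and (ii) for any $P\in\mathcal{P}$, when $(\zeta_1,\zeta_2,\ldots)\sim P$, the sequences $\zeta_1,\ldots,\zeta_n$ and $\zeta_{n+1},\zeta_{n+2},\ldots$ are conditionally independent given $S_n(\zeta_1,\ldots,\zeta_n)$. An ATTS sequence is a sequence of statistics that is both algebraically transitive and totally sufficient. The statistic $S_n$ is boundedly complete with respect to $\mathcal{P}$ if, for any bounded measurable $f:\Sigma_n\to\mathbb{R}$, $\mathbb{E}_P(f(S_n(\zeta_1,\ldots,\zeta_n)))=0$ for all $P\in\mathcal{P}$ only if $f(S_n(\zeta_1,\ldots,\zeta_n))=0$ $P$-almost surely for all $P\in\mathcal{P}$. A confidence predictor $\Gamma$ is a measurable strategy assigning to every significance level $\epsilon\in(0,1)$, every $n\ge1$ and every $\mathbf{x}_1,y_1,\ldots,\mathbf{x}_{n-1},y_{n-1},\mathbf{x}_n$ a prediction region $\Gamma_n^{\epsilon}=\Gamma^{\epsilon}(\mathbf{x}_1,y_1,\ldots,\mathbf{x}_{n-1},y_{n-1},\mathbf{x}_n)\subseteq\mathbb{R}$ (measurable meaning that for each $n$ the set of $(\epsilon,\mathbf{x}_1,y_1,\ldots,\mathbf{x}_n,y_n)$ with $y_n\in\Gamma_n^{\epsilon}$ is measurable), with the nestedness property $\Gamma_n^{\epsilon_1}\subseteq\Gamma_n^{\epsilon_2}$ whenever $\epsilon_1>\epsilon_2$. It makes an error at step $n$ and level $\epsilon$ if $y_n\notin\Gamma_n^{\epsilon}$. $\Gamma$ is weakly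 valid for $n\in\mathcal{N}$ if, for all $n\in\mathcal{N}$, all $\epsilon\in(0,1)$ and all $P\in\mathcal{P}$, the probability under $P$ that $y_n\notin\Gamma_n^{\epsilon}$ equals $\epsilon$. $\Gamma$ is invariant if, for $n>1$, $\Gamma_n^{\epsilon}$ depends on the first $n-1$ observations only through the value of $S_{n-1}$ on those observations (besides depending on $\epsilon$ and $\mathbf{x}_n$). A nonconformity measure is any sequence of measurable functions $A_n:\Sigma_{n-1}\times Z\to\mathbb{R}$, $n=1,2,\ldots$. The corresponding $p$-values (with $\tau_n=1$) are $$p_n(\zeta_1,\ldots,\zeta_n,1):=\Pr\left(A_n^{\mathrm{rnd}}\ge A_n^{\mathrm{obs}}\mid S_n^{\mathrm{rnd}}=S_n^{\mathrm{obs}}\right),$$ where $A_n^{\mathrm{rnd}}:=A_n(S_{n-1}(\xi_1,\ldots,\xi_{n-1}),\xi_n)$, $S_n^{\mathrm{rnd}}:=S_n(\xi_1,\ldots,\xi_n)$ are random, $A_n^{\mathrm{obs}}:=A_n(S_{n-1}(\zeta_1,\ldots,\zeta_{n-1}),\zeta_n)$, $S_n^{\mathrm{obs}}:=S_n(\zeta_1,\ldots,\zeta_n)$ are the observed values treated as fixed, and the conditional probability is over $(\xi_1,\xi_2,\ldots)\sim P$, computed using the fixed common regular conditional distribution given $S_n$ (so it does not depend on $P\in\mathcal{P}$). A conformal predictor is a confidence predictor of the form $$\Gamma^{\epsilon}(\mathbf{x}_1,y_1,\ldots,\mathbf{x}_{n-1},y_{n-1},\mathbf{x}_n):=\{y\in\mathbb{R}: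 p_n((\mathbf{x}_1,y_1),\ldots,(\mathbf{x}_{n-1},y_{n-1}),(\mathbf{x}_n,y),1)>\epsilon\}$$ for some nonconformity measure $(A_n)$. A confidence predictor $\Gamma^{\dagger}$ is at least as accurate as another confidence predictor $\Gamma$ for $n\in\mathcal{N}$ if $$(\Gamma^{\dagger})^{\epsilon}(\mathbf{x}_1,y_1,\ldots,\mathbf{x}_{n-1},y_{n-1},\mathbf{x}_n)\subseteq\Gamma^{\epsilon}(\mathbf{x}_1,y_1,\ldots,\mathbf{x}_{n-1},y_{n-1},\mathbf{x}_n)$$ for all $\epsilon\in(0,1)$, all $n\in\mathcal{N}$, and $P$-almost all $\mathbf{x}_1,y_1,\ldots,\mathbf{x}_{n-1},y_{n-1},\mathbf{x}_n$, under any probability distribution $P\in\mathcal{P}$.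
   Formalization: The p-values use a suitably chosen version of the common regular conditional distribution (for an arbitrary fixed version the claim fails on null sets), and invariance requires the region to depend measurably on the value of S_{n-1} (otherwise false for general measurable spaces). *)

theory Defs
  imports "HOL-Probability.Probability"
begin

text \<open>
  An observation is a pair of a vector of explanatory variables and a label. Observations are
  numbered from 1, so a sequence of \<open>n\<close> observations is an extensional function on \<open>{1..n}\<close>.
\<close>

type_synonym 'k observation = "(real, 'k) vec \<times> real"

definition obs_space :: "nat \<Rightarrow> (nat \<Rightarrow> 'k::finite observation) measure" where
  "obs_space n = (\<Pi>\<^sub>M i\<in>{1..n}. borel)"

definition future_space :: "nat \<Rightarrow> (nat \<Rightarrow> 'k::finite observation) measure" where
  "future_space n = (\<Pi>\<^sub>M i\<in>{n<..}. borel)"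

abbreviation seq_space :: "(nat \<Rightarrow> 'k::finite observation) measure" where
  "seq_space \<equiv> future_space 0"

abbreviation first :: "nat \<Rightarrow> (nat \<Rightarrow> 'a) \<Rightarrow> nat \<Rightarrow> 'a" where
  "first n \<zeta> \<equiv> restrict \<zeta> {1..n}"

definition statistical_model :: "(nat \<Rightarrow> 'k::finite observation) measure set \<Rightarrow> bool" where
  "statistical_model \<P> \<longleftrightarrow> \<P> \<subseteq> space (prob_algebra seq_space)"

text \<open>
  The summary spaces \<open>\<Sigma> n\<close> are measures of which only the measurable-space part is used; one
  carrier type for all \<open>n\<close> is no restriction, since countably many spaces embed into a disjoint
  union. As \<open>obs_space 0\<close> has exactly one point, the case \<open>n = 0\<close> below says that \<open>\<Sigma> 0\<close>
  is a one-element space.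
\<close>

definition statistics ::
  "(nat \<Rightarrow> 's measure) \<Rightarrow> (nat \<Rightarrow> (nat \<Rightarrow> 'k::finite observation) \<Rightarrow> 's) \<Rightarrow> bool" where
  "statistics \<Sigma> S \<longleftrightarrow>
     (\<forall>n. S n \<in> obs_space n \<rightarrow>\<^sub>M \<Sigma> n \<and> space (\<Sigma> n) = S n ` space (obs_space n))"

definition algebraically_transitive ::
  "(nat \<Rightarrow> 's measure) \<Rightarrow> (nat \<Rightarrow> (nat \<Rightarrow> 'k::finite observation) \<Rightarrow> 's) \<Rightarrow> bool" where
  "algebraically_transitive \<Sigma> S \<longleftrightarrow>
     (\<exists>F. \<forall>n\<ge>2. F n \<in> \<Sigma> (n - 1) \<Otimes>\<^sub>M borel \<rightarrow>\<^sub>M \<Sigma> n \<and>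
        (\<forall>\<zeta>\<in>space (obs_space n). S n \<zeta> = F n (S (n - 1) (first (n - 1) \<zeta>), \<zeta> n)))"

definition cprob :: "'a measure \<Rightarrow> 'a measure \<Rightarrow> 'a set \<Rightarrow> 'a \<Rightarrow> real" where
  "cprob M G E = real_cond_exp M G (indicator E)"

definition cond_indep_given ::
  "'a measure \<Rightarrow> 'a measure \<Rightarrow> ('a \<Rightarrow> 'b) \<Rightarrow> 'b measure \<Rightarrow> ('a \<Rightarrow> 'c) \<Rightarrow> 'c measure \<Rightarrow> bool" where
  "cond_indep_given M G X M\<^sub>X Y M\<^sub>Y \<longleftrightarrow>
     (\<forall>B\<in>sets M\<^sub>X. \<forall>C\<in>sets M\<^sub>Y. AE \<omega> in M.
        cprob M G ((X -` B) \<inter> (Y -` C) \<inter> space M) \<omega> =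
        cprob M G (X -` B \<inter> space M) \<omega> * cprob M G (Y -` C \<inter> space M) \<omega>)"

text \<open>The \<open>\<sigma>\<close>-algebra on the space of infinite sequences generated by the \<open>n\<close>-th statistic.\<close>

definition stat_algebra ::
  "(nat \<Rightarrow> 's measure) \<Rightarrow> (nat \<Rightarrow> (nat \<Rightarrow> 'k::finite observation) \<Rightarrow> 's) \<Rightarrow> nat \<Rightarrow>
    (nat \<Rightarrow> 'k observation) measure" where
  "stat_algebra \<Sigma> S n = vimage_algebra (space seq_space) (\<lambda>\<omega>. S n (first n \<omega>)) (\<Sigma> n)"

definition common_rcd ::
  "(nat \<Rightarrow> 'k::finite observation) measure set \<Rightarrow> (nat \<Rightarrow> 's measure) \<Rightarrow>
    (nat \<Rightarrow> (nat \<Rightarrow> 'k observation) \<Rightarrow> 's) \<Rightarrow> nat \<Rightarrow>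
    ('s \<Rightarrow> (nat \<Rightarrow> 'k observation) measure) \<Rightarrow> bool" where
  "common_rcd \<P> \<Sigma> S n \<kappa> \<longleftrightarrow>
     \<kappa> \<in> \<Sigma> n \<rightarrow>\<^sub>M prob_algebra (obs_space n) \<and>
     (\<forall>P\<in>\<P>. \<forall>B\<in>sets (obs_space n). AE \<omega> in P.
        measure (\<kappa> (S n (first n \<omega>))) B =
        cprob P (stat_algebra \<Sigma> S n) (first n -` B \<inter> space P) \<omega>)"

definition sufficient ::
  "(nat \<Rightarrow> 'k::finite observation) measure set \<Rightarrow> (nat \<Rightarrow> 's measure) \<Rightarrow>
    (nat \<Rightarrow> (nat \<Rightarrow> 'k observation) \<Rightarrow> 's) \<Rightarrow> nat \<Rightarrow> bool" where
  "sufficient \<P> \<Sigma> S n \<longleftrightarrow> (\<exists>\<kappa>. common_rcd \<P> \<Sigma> S n \<kappa>)"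

definition totally_sufficient ::
  "(nat \<Rightarrow> 'k::finite observation) measure set \<Rightarrow> (nat \<Rightarrow> 's measure) \<Rightarrow>
    (nat \<Rightarrow> (nat \<Rightarrow> 'k observation) \<Rightarrow> 's) \<Rightarrow> bool" where
  "totally_sufficient \<P> \<Sigma> S \<longleftrightarrow>
     (\<forall>n\<ge>1. sufficient \<P> \<Sigma> S n \<and>
        (\<forall>P\<in>\<P>. cond_indep_given P (stat_algebra \<Sigma> S n)
           (first n) (obs_space n) (\<lambda>\<omega>. restrict \<omega> {n<..}) (future_space n)))"

definition ATTS ::
  "(nat \<Rightarrow> 'k::finite observation) measure set \<Rightarrow> (nat \<Rightarrow> 's measure) \<Rightarrow>
    (nat \<Rightarrow> (nat \<Rightarrow> 'k observation) \<Rightarrow> 's) \<Rightarrow> bool" where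
  "ATTS \<P> \<Sigma> S \<longleftrightarrow>
     statistics \<Sigma> S \<and> algebraically_transitive \<Sigma> S \<and> totally_sufficient \<P> \<Sigma> S"

definition boundedly_complete ::
  "(nat \<Rightarrow> 'k::finite observation) measure set \<Rightarrow> (nat \<Rightarrow> 's measure) \<Rightarrow>
    (nat \<Rightarrow> (nat \<Rightarrow> 'k observation) \<Rightarrow> 's) \<Rightarrow> nat \<Rightarrow> bool" where
  "boundedly_complete \<P> \<Sigma> S n \<longleftrightarrow>
     (\<forall>f :: 's \<Rightarrow> real. f \<in> borel_measurable (\<Sigma> n) \<longrightarrow> bounded (f ` space (\<Sigma> n)) \<longrightarrow>
        (\<forall>P\<in>\<P>. (\<integral>\<omega>. f (S n (first n \<omega>)) \<partial>P) = 0) \<longrightarrow>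
        (\<forall>P\<in>\<P>. AE \<omega> in P. f (S n (first n \<omega>)) = 0))"

text \<open>
  \<open>\<Gamma> n \<epsilon> past x\<close> is the prediction region at step \<open>n\<close>, where \<open>past\<close> is the sequence of the
  first \<open>n - 1\<close> observations and \<open>x\<close> is the \<open>n\<close>-th vector of explanatory variables. Only the
  values for \<open>n \<ge> 1\<close>, \<open>0 < \<epsilon> < 1\<close> and \<open>past\<close> in \<open>obs_space (n - 1)\<close> are relevant.
\<close>

type_synonym 'k predictor =
  "nat \<Rightarrow> real \<Rightarrow> (nat \<Rightarrow> 'k observation) \<Rightarrow> (real, 'k) vec \<Rightarrow> real set"

definition covers :: "'k::finite predictor \<Rightarrow> nat \<Rightarrow> real \<Rightarrow> (nat \<Rightarrow> 'k observation) \<Rightarrow> bool" where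
  "covers \<Gamma> n \<epsilon> \<zeta> \<longleftrightarrow> snd (\<zeta> n) \<in> \<Gamma> n \<epsilon> (first (n - 1) \<zeta>) (fst (\<zeta> n))"

definition confidence_predictor :: "'k::finite predictor \<Rightarrow> bool" where
  "confidence_predictor \<Gamma> \<longleftrightarrow>
     (\<forall>n\<ge>1.
        {(\<epsilon>, \<zeta>). \<epsilon> \<in> {0<..<1} \<and> \<zeta> \<in> space (obs_space n) \<and> covers \<Gamma> n \<epsilon> \<zeta>}
          \<in> sets (borel \<Otimes>\<^sub>M obs_space n) \<and>
        (\<forall>\<epsilon>\<^sub>1\<in>{0<..<1}. \<forall>\<epsilon>\<^sub>2\<in>{0<..<1}. \<forall>past\<in>space (obs_space (n - 1)). \<forall>x.
           \<epsilon>\<^sub>1 > \<epsilon>\<^sub>2 \<longrightarrow> \<Gamma> n \<epsilon>\<^sub>1 past x \<subseteq> \<Gamma> n \<epsilon>\<^sub>2 past x))"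

definition weakly_valid ::
  "(nat \<Rightarrow> 'k::finite observation) measure set \<Rightarrow> nat set \<Rightarrow> 'k predictor \<Rightarrow> bool" where
  "weakly_valid \<P> \<N> \<Gamma> \<longleftrightarrow>
     (\<forall>n\<in>\<N>. \<forall>\<epsilon>\<in>{0<..<1}. \<forall>P\<in>\<P>. measure P {\<omega>\<in>space P. \<not> covers \<Gamma> n \<epsilon> \<omega>} = \<epsilon>)"

text \<open>
  Dependence through the statistic is meant measurably: the region is obtained from the value of
  the statistic and \<open>x\<close> by a rule that is itself measurable on \<open>\<Sigma> (n - 1)\<close>. For arbitrary
  measurable spaces this does not follow from mere constancy on the fibres of the statistic.
\<close>

definition invariant ::
  "(nat \<Rightarrow> 's measure) \<Rightarrow> (nat \<Rightarrow> (nat \<Rightarrow> 'k::finite observation) \<Rightarrow> 's) \<Rightarrow>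
    'k predictor \<Rightarrow> bool" where
  "invariant \<Sigma> S \<Gamma> \<longleftrightarrow>
     (\<forall>n>1. \<forall>\<epsilon>\<in>{0<..<1}. \<exists>G.
        {(s, (x, y)). s \<in> space (\<Sigma> (n - 1)) \<and> y \<in> G s x} \<in> sets (\<Sigma> (n - 1) \<Otimes>\<^sub>M borel) \<and>
        (\<forall>past\<in>space (obs_space (n - 1)). \<forall>x. \<Gamma> n \<epsilon> past x = G (S (n - 1) past) x))"

definition nonconformity_measure ::
  "(nat \<Rightarrow> 's measure) \<Rightarrow> (nat \<Rightarrow> 's \<times> 'k::finite observation \<Rightarrow> real) \<Rightarrow> bool" where
  "nonconformity_measure \<Sigma> A \<longleftrightarrow> (\<forall>n\<ge>1. A n \<in> borel_measurable (\<Sigma> (n - 1) \<Otimes>\<^sub>M borel))"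

definition nonconformity_score ::
  "(nat \<Rightarrow> (nat \<Rightarrow> 'k::finite observation) \<Rightarrow> 's) \<Rightarrow> (nat \<Rightarrow> 's \<times> 'k observation \<Rightarrow> real) \<Rightarrow>
    nat \<Rightarrow> (nat \<Rightarrow> 'k observation) \<Rightarrow> real" where
  "nonconformity_score S A n \<zeta> = A n (S (n - 1) (first (n - 1) \<zeta>), \<zeta> n)"

definition p_value ::
  "(nat \<Rightarrow> (nat \<Rightarrow> 'k::finite observation) \<Rightarrow> 's) \<Rightarrow>
    (nat \<Rightarrow> 's \<Rightarrow> (nat \<Rightarrow> 'k observation) measure) \<Rightarrow>
    (nat \<Rightarrow> 's \<times> 'k observation \<Rightarrow> real) \<Rightarrow> nat \<Rightarrow> (nat \<Rightarrow> 'k observation) \<Rightarrow> real" where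
  "p_value S \<kappa> A n \<zeta> =
     measure (\<kappa> n (S n \<zeta>))
       {\<xi> \<in> space (obs_space n). nonconformity_score S A n \<xi> \<ge> nonconformity_score S A n \<zeta>}"

text \<open>
  The kernels \<open>\<kappa> n\<close> are the version of the common regular conditional distributions from which
  the p-values are computed. Two versions agree only almost surely, and the prediction regions
  (as subsets of the real line) do depend on the version, so it is an explicit parameter.
\<close>

definition conformal_predictor ::
  "(nat \<Rightarrow> 's measure) \<Rightarrow> (nat \<Rightarrow> (nat \<Rightarrow> 'k::finite observation) \<Rightarrow> 's) \<Rightarrow>
    (nat \<Rightarrow> 's \<Rightarrow> (nat \<Rightarrow> 'k observation) measure) \<Rightarrow> 'k predictor \<Rightarrow> bool" where
  "conformal_predictor \<Sigma> S \<kappa> \<Gamma> \<longleftrightarrow>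
     confidence_predictor \<Gamma> \<and>
     (\<exists>A. nonconformity_measure \<Sigma> A \<and>
        (\<forall>n\<ge>1. \<forall>\<epsilon>\<in>{0<..<1}. \<forall>past\<in>space (obs_space (n - 1)). \<forall>x.
           \<Gamma> n \<epsilon> past x = {y. p_value S \<kappa> A n (past(n := (x, y))) > \<epsilon>}))"

definition at_least_as_accurate ::
  "(nat \<Rightarrow> 'k::finite observation) measure set \<Rightarrow> nat set \<Rightarrow> 'k predictor \<Rightarrow> 'k predictor \<Rightarrow> bool" where
  "at_least_as_accurate \<P> \<N> \<Gamma>' \<Gamma> \<longleftrightarrow>
     (\<forall>P\<in>\<P>. \<forall>\<epsilon>\<in>{0<..<1}. \<forall>n\<in>\<N>.
        AE (past, x) in distr P (obs_space (n - 1) \<Otimes>\<^sub>M borel)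
            (\<lambda>\<omega>. (first (n - 1) \<omega>, fst (\<omega> n))).
          \<Gamma>' n \<epsilon> past x \<subseteq> \<Gamma> n \<epsilon> past x)"

end

theory Submission
  imports Defs
begin

text \<open>
  Fix \<open>n \<in> \<N>\<close>. Weak validity gives the error event at level \<open>\<epsilon>\<close> the same probability \<open>\<epsilon>\<close> under
  every \<open>P \<in> \<P>\<close>. By sufficiency the conditional probability of this event given \<open>S n\<close> is one function
  of \<open>S n\<close> for all \<open>P\<close>, and this function minus \<open>\<epsilon>\<close> is bounded with expectation 0 under every \<open>P\<close>.
  Bounded completeness turns this into a conditional statement: almost surely, the error
  probability given \<open>S n\<close> is \<open>\<epsilon>\<close> (\<open>boundedly_complete_cond_prob\<close>).

  Since the regions shrink as the level grows, everything \<open>\<Gamma>\<close> says about the observations \<open>\<zeta>\<close> at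
  step \<open>n\<close> is, up to boundary levels, contained in one number: the critical level \<open>g \<zeta>\<close>, the
  supremum of the levels at which \<open>\<zeta>\<close> is covered. It behaves like a p-value: \<open>g \<zeta> \<le> t\<close> forces an
  error at every level above \<open>t\<close>, so its conditional distribution function at \<open>t\<close> is at most \<open>t\<close>
  (\<open>measure_critical_level_le\<close>). By invariance \<open>-g\<close> is a function of \<open>S (n - 1)\<close> and the \<open>n\<close>-th
  observation, that is, a nonconformity measure (\<open>invariant_critical_level_factors\<close>). Its p-value
  at \<open>\<zeta>\<close> is the conditional probability of \<open>{\<xi>. g \<xi> \<le> g \<zeta>}\<close>, hence at most \<open>g \<zeta>\<close>
  (\<open>p_value_le_critical_level\<close>). If it exceeds \<open>\<epsilon>\<close>, then \<open>\<zeta>\<close> is covered at some level above \<open>\<epsilon>\<close>, and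
  so at \<open>\<epsilon>\<close>. This is the required inclusion.

  One difficulty is left. The inclusion must hold for almost all past observations and \<open>x\<close> but for
  every label \<open>y\<close>, and some labels can lead to a value of \<open>S n\<close> in the null set where the
  conditional error probabilities are wrong. But the
  bound on the p-value holds for every distribution with exact error probabilities. So on the null
  set the conditional distribution is replaced by the one at some fixed value outside it
  (\<open>common_rcd_with_exact_error_levels\<close>). The result is still a version of the common conditional
  distribution, and the inclusion then holds everywhere.
\<close>

section \<open>The critical level of a nested family\<close>

text \<open>
  Only rational levels enter, which makes the supremum a countable one and so measurable. The
  value 0 at levels where \<open>C\<close> fails keeps the supremum over a nonempty bounded set.
\<close>

definition critical_level :: "(real \<Rightarrow> bool) \<Rightarrow> real" where
  "critical_level C = (SUP q\<in>\<rat> \<inter> {0<..<1}. if C q then q else 0)"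

lemma rational_levels_nonempty: "\<rat> \<inter> {0<..<1::real} \<noteq> {}"
  using Rats_dense_in_real[of 0 1] by auto

lemma critical_level_bdd_above:
  "bdd_above ((\<lambda>q::real. if C q then q else 0) ` (\<rat> \<inter> {0<..<1}))"
  by (rule bdd_aboveI[of _ 1]) auto

lemma critical_level_upper:
  assumes "q \<in> \<rat> \<inter> {0<..<1}" "C q"
  shows "q \<le> critical_level C"
  unfolding critical_level_def
  using cSUP_upper[OF assms(1) critical_level_bdd_above[of C]] assms(2) by simp

lemma critical_level_nonneg: "0 \<le> critical_level C"
proof -
  obtain q :: real where q: "q \<in> \<rat> \<inter> {0<..<1}"
    using rational_levels_nonempty by blast
  have "0 \<le> (if C q then q else 0)" using q by auto
  also have "\<dots> \<le> critical_level C"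
    unfolding critical_level_def by (rule cSUP_upper[OF q critical_level_bdd_above])
  finally show ?thesis .
qed

lemma less_critical_levelD:
  assumes "0 \<le> t" "t < critical_level C"
  obtains q where "q \<in> \<rat> \<inter> {0<..<1}" "t < q" "C q"
proof -
  obtain q where "q \<in> \<rat> \<inter> {0<..<1}" "t < (if C q then q else 0)"
    using assms(2) less_cSUP_iff[OF rational_levels_nonempty critical_level_bdd_above[of C], of t]
    unfolding critical_level_def by auto
  with assms(1) show thesis
    by (intro that[of q]) (auto split: if_splits)
qed

lemma borel_measurable_critical_level:
  assumes "\<And>q. q \<in> \<rat> \<inter> {0<..<1} \<Longrightarrow> {x \<in> space M. C x q} \<in> sets M"
  shows "(\<lambda>x. critical_level (C x)) \<in> borel_measurable M"
  unfolding critical_level_def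
proof (rule borel_measurable_cSUP)
  show "countable (\<rat> \<inter> {0<..<1::real})"
    using countable_rat by (rule countable_Int1)
  show "(\<lambda>x. if C x q then q else 0) \<in> borel_measurable M" if "q \<in> \<rat> \<inter> {0<..<1}" for q
    using assms[OF that] by (intro measurable_If) auto
qed (rule critical_level_bdd_above)

text \<open>
  A critical level of at most \<open>t\<close> makes \<open>C q\<close> fail for every rational \<open>q > t\<close>, an event of probability
  \<open>q\<close>; let \<open>q\<close> decrease to \<open>t\<close>. In other words, the critical level is stochastically at least as
  large as a uniform variable, which is the validity property of a p-value.
\<close>

lemma measure_critical_level_le:
  assumes "prob_space M"
    and meas: "\<And>q. q \<in> \<rat> \<inter> {0<..<1} \<Longrightarrow> {x \<in> space M. C x q} \<in> sets M"
    and size: "\<And>q. q \<in> \<rat> \<inter> {0<..<1} \<Longrightarrow> measure M {x \<in> space M. \<not> C x q} = q"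
    and "0 \<le> t"
  shows "measure M {x \<in> space M. critical_level (C x) \<le> t} \<le> t"
proof (cases "t < 1")
  case False
  interpret prob_space M by fact
  show ?thesis using prob_le_1 False by (meson le_less_trans not_le order_trans less_imp_le)
next
  case True
  interpret prob_space M by fact
  show ?thesis
  proof (rule field_le_epsilon)
    fix e :: real assume "0 < e"
    then obtain q where q: "q \<in> \<rat>" "t < q" "q < min 1 (t + e)"
      using Rats_dense_in_real[of t "min 1 (t + e)"] True by auto
    then have q01: "q \<in> \<rat> \<inter> {0<..<1}" using \<open>0 \<le> t\<close> by auto
    have "{x \<in> space M. \<not> C x q} = space M - {x \<in> space M. C x q}" by auto
    then have "{x \<in> space M. \<not> C x q} \<in> sets M" using meas[OF q01] by auto
    moreover have "\<not> C x q" if "critical_level (C x) \<le> t" for x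
    proof
      assume "C x q"
      from critical_level_upper[of q "C x", OF q01 this] that q(2) show False by simp
    qed
    then have "{x \<in> space M. critical_level (C x) \<le> t} \<subseteq> {x \<in> space M. \<not> C x q}"
      by blast
    ultimately have "measure M {x \<in> space M. critical_level (C x) \<le> t}
        \<le> measure M {x \<in> space M. \<not> C x q}"
      by (intro finite_measure_mono)
    then show "measure M {x \<in> space M. critical_level (C x) \<le> t} \<le> t + e"
      using size[OF q01] q(3) by simp
  qed
qed

section \<open>Finite and infinite observation sequences\<close>

lemma first_in_obs_space: "first n \<zeta> \<in> space (obs_space n)"
  by (auto simp: obs_space_def space_PiM)

lemma measurable_first: "m \<le> n \<Longrightarrow> first m \<in> obs_space n \<rightarrow>\<^sub>M obs_space m"
  unfolding obs_space_def by (rule measurable_restrict_subset) auto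

lemma measurable_first_seq: "first n \<in> seq_space \<rightarrow>\<^sub>M obs_space n"
  unfolding obs_space_def future_space_def by (rule measurable_restrict_subset) auto

lemma measurable_statistic: "statistics \<Sigma> S \<Longrightarrow> S n \<in> obs_space n \<rightarrow>\<^sub>M \<Sigma> n"
  by (simp add: statistics_def)

lemma measurable_statistic_seq:
  "statistics \<Sigma> S \<Longrightarrow> (\<lambda>\<omega>. S n (first n \<omega>)) \<in> seq_space \<rightarrow>\<^sub>M \<Sigma> n"
  by (rule measurable_compose[OF measurable_first_seq measurable_statistic])

lemma first_upd_last:
  assumes "n \<ge> 1" "\<zeta> \<in> space (obs_space n)"
  shows "(first (n - 1) \<zeta>)(n := \<zeta> n) = \<zeta>"
  using assms by (auto simp: obs_space_def space_PiM fun_eq_iff PiE_def extensional_def)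

lemma past_upd_obs:
  assumes "n \<ge> 1" "past \<in> space (obs_space (n - 1))"
  shows "past(n := z) \<in> space (obs_space n)" "first (n - 1) (past(n := z)) = past"
  using assms by (auto simp: obs_space_def space_PiM fun_eq_iff PiE_def extensional_def)

lemma covers_first:
  assumes "n \<ge> 1"
  shows "covers \<Gamma> n \<epsilon> (first n \<omega>) \<longleftrightarrow> covers \<Gamma> n \<epsilon> \<omega>"
proof -
  have "{1..n} \<inter> {1..n - 1} = {1..n - 1}" by auto
  then show ?thesis using assms by (simp add: covers_def)
qed

lemma sets_covers:
  assumes "confidence_predictor \<Gamma>" "n \<ge> 1" "\<epsilon> \<in> {0<..<1}"
  shows "{\<zeta> \<in> space (obs_space n). covers \<Gamma> n \<epsilon> \<zeta>} \<in> sets (obs_space n)"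
proof -
  let ?E = "{(\<epsilon>, \<zeta>). \<epsilon> \<in> {0<..<1} \<and> \<zeta> \<in> space (obs_space n) \<and> covers \<Gamma> n \<epsilon> \<zeta>}"
  have "?E \<in> sets (borel \<Otimes>\<^sub>M obs_space n)"
    using assms by (auto simp: confidence_predictor_def)
  then have "Pair \<epsilon> -` ?E \<in> sets (obs_space n)" by (rule sets_Pair1)
  also have "Pair \<epsilon> -` ?E = {\<zeta> \<in> space (obs_space n). covers \<Gamma> n \<epsilon> \<zeta>}"
    using assms(3) by auto
  finally show ?thesis .
qed

lemma confidence_predictor_mono:
  assumes "confidence_predictor \<Gamma>" "n \<ge> 1" "past \<in> space (obs_space (n - 1))"
    and "\<epsilon> \<in> {0<..<1}" "q \<in> {0<..<1}" "\<epsilon> < q"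
  shows "\<Gamma> n q past x \<subseteq> \<Gamma> n \<epsilon> past x"
  using assms unfolding confidence_predictor_def by blast

text \<open>
  The first step of the predictor is not governed by invariance. There is only one empty past, so
  the region is a function of \<open>x\<close> alone, and its measurability comes from that of the predictor.
\<close>

lemma invariant_region_rule:
  assumes \<Gamma>: "confidence_predictor \<Gamma>" and inv: "invariant \<Sigma> S \<Gamma>"
    and n: "n \<ge> 1" and \<epsilon>: "\<epsilon> \<in> {0<..<1}"
  shows "\<exists>G. {(s, (x, y)). s \<in> space (\<Sigma> (n - 1)) \<and> y \<in> G s x} \<in> sets (\<Sigma> (n - 1) \<Otimes>\<^sub>M borel) \<and>
    (\<forall>past\<in>space (obs_space (n - 1)). \<forall>x. \<Gamma> n \<epsilon> past x = G (S (n - 1) past) x)"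
proof (cases "n = 1")
  case False
  with inv n \<epsilon> show ?thesis by (auto simp: invariant_def)
next
  case True
  let ?o = "\<lambda>_::nat. undefined :: 'a observation"
  let ?G = "\<lambda>_::'b. \<Gamma> 1 \<epsilon> ?o"
  let ?one = "\<lambda>z :: 'a observation. \<lambda>i\<in>{1..1::nat}. z"
  have one: "?one \<in> borel \<rightarrow>\<^sub>M obs_space 1"
    unfolding obs_space_def by (rule measurable_restrict) simp
  have past: "past = ?o" if "past \<in> space (obs_space 0)" for past
    using that by (auto simp: obs_space_def space_PiM)
  have "?one -` {\<zeta> \<in> space (obs_space 1). covers \<Gamma> 1 \<epsilon> \<zeta>} \<inter> space borel \<in> sets borel"
    using sets_covers[OF \<Gamma> _ \<epsilon>, of 1] by (intro measurable_sets[OF one]) simp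
  also have "?one -` {\<zeta> \<in> space (obs_space 1). covers \<Gamma> 1 \<epsilon> \<zeta>} \<inter> space borel
      = {(x, y). y \<in> \<Gamma> 1 \<epsilon> ?o x}"
    using measurable_space[OF one] by (auto simp: covers_def restrict_def)
  finally have *: "{(x, y). y \<in> \<Gamma> 1 \<epsilon> ?o x} \<in> sets borel" .
  have "space (\<Sigma> 0) \<times> {(x, y). y \<in> \<Gamma> 1 \<epsilon> ?o x} \<in> sets (\<Sigma> 0 \<Otimes>\<^sub>M borel)"
    using * by (intro pair_measureI) auto
  also have "space (\<Sigma> 0) \<times> {(x, y). y \<in> \<Gamma> 1 \<epsilon> ?o x} =
      {(s, (x, y)). s \<in> space (\<Sigma> 0) \<and> y \<in> ?G s x}"
    by auto
  finally show ?thesis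
    using True past by (intro exI[of _ ?G]) auto
qed

section \<open>The nonconformity measure of an invariant predictor\<close>

text \<open>
  The regions at each level factor through the statistic, by a rule \<open>G\<close> chosen separately for each
  level. A supremum over countably many levels combines these separate rules into one measurable
  function. The sign is reversed because a low critical level marks an unusual observation.
\<close>

lemma invariant_critical_level_factors:
  fixes \<Gamma> :: "'k::finite predictor" and \<Sigma> :: "nat \<Rightarrow> 's measure"
  assumes "confidence_predictor \<Gamma>" "invariant \<Sigma> S \<Gamma>"
  shows "\<exists>A. nonconformity_measure \<Sigma> A \<and> (\<forall>n\<ge>1. \<forall>\<zeta>.
    nonconformity_score S A n \<zeta> = - critical_level (\<lambda>\<epsilon>. covers \<Gamma> n \<epsilon> \<zeta>))"
proof -
  have "\<forall>n \<epsilon>. \<exists>G. n \<ge> 1 \<longrightarrow> \<epsilon> \<in> {0<..<1} \<longrightarrow>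
    {(s, (x, y)). s \<in> space (\<Sigma> (n - 1)) \<and> y \<in> G s x} \<in> sets (\<Sigma> (n - 1) \<Otimes>\<^sub>M borel) \<and>
    (\<forall>past\<in>space (obs_space (n - 1)). \<forall>x. \<Gamma> n \<epsilon> past x = G (S (n - 1) past) x)"
    using invariant_region_rule[OF assms] by blast
  then obtain G where G: "\<And>n \<epsilon>. n \<ge> 1 \<Longrightarrow> \<epsilon> \<in> {0<..<1} \<Longrightarrow>
      {(s, (x, y)). s \<in> space (\<Sigma> (n - 1)) \<and> y \<in> G n \<epsilon> s x} \<in> sets (\<Sigma> (n - 1) \<Otimes>\<^sub>M borel)"
    "\<And>n \<epsilon> past x. n \<ge> 1 \<Longrightarrow> \<epsilon> \<in> {0<..<1} \<Longrightarrow> past \<in> space (obs_space (n - 1)) \<Longrightarrow>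
      \<Gamma> n \<epsilon> past x = G n \<epsilon> (S (n - 1) past) x"
    unfolding choice_iff by blast
  define A where "A n = (\<lambda>(s, x, y). - critical_level (\<lambda>\<epsilon>. y \<in> G n \<epsilon> s x))" for n
  have "nonconformity_measure \<Sigma> A"
    unfolding nonconformity_measure_def
  proof (intro allI impI)
    fix n :: nat assume n: "n \<ge> 1"
    have "(\<lambda>w. critical_level (\<lambda>\<epsilon>. snd (snd w) \<in> G n \<epsilon> (fst w) (fst (snd w))))
        \<in> borel_measurable (\<Sigma> (n - 1) \<Otimes>\<^sub>M borel)"
    proof (rule borel_measurable_critical_level)
      fix q :: real assume "q \<in> \<rat> \<inter> {0<..<1}"
      then have "{(s, (x, y)). s \<in> space (\<Sigma> (n - 1)) \<and> y \<in> G n q s x}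
          \<in> sets (\<Sigma> (n - 1) \<Otimes>\<^sub>M borel)"
        using G(1)[OF n] by auto
      also have "{(s, (x, y)). s \<in> space (\<Sigma> (n - 1)) \<and> y \<in> G n q s x} =
          {w \<in> space (\<Sigma> (n - 1) \<Otimes>\<^sub>M borel). snd (snd w) \<in> G n q (fst w) (fst (snd w))}"
        by (auto simp: space_pair_measure)
      finally show "\<dots> \<in> sets (\<Sigma> (n - 1) \<Otimes>\<^sub>M borel)" .
    qed
    then show "A n \<in> borel_measurable (\<Sigma> (n - 1) \<Otimes>\<^sub>M borel)"
      by (simp add: A_def case_prod_beta')
  qed
  moreover have "nonconformity_score S A n \<zeta> = - critical_level (\<lambda>\<epsilon>. covers \<Gamma> n \<epsilon> \<zeta>)"
    if n: "n \<ge> 1" for n \<zeta>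
  proof -
    have "snd (\<zeta> n) \<in> G n q (S (n - 1) (first (n - 1) \<zeta>)) (fst (\<zeta> n)) \<longleftrightarrow> covers \<Gamma> n q \<zeta>"
      if "q \<in> {0<..<1}" for q
      unfolding covers_def G(2)[OF n that first_in_obs_space] ..
    then have "critical_level (\<lambda>q. snd (\<zeta> n) \<in> G n q (S (n - 1) (first (n - 1) \<zeta>)) (fst (\<zeta> n)))
        = critical_level (\<lambda>\<epsilon>. covers \<Gamma> n \<epsilon> \<zeta>)"
      unfolding critical_level_def by (intro SUP_cong) auto
    then show ?thesis
      by (simp add: nonconformity_score_def A_def case_prod_beta')
  qed
  ultimately show ?thesis by blast
qed

section \<open>Conditional error probabilities under bounded completeness\<close>

lemma subalgebra_stat_algebra:
  assumes "statistics \<Sigma> S" "sets P = sets seq_space"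
  shows "subalgebra P (stat_algebra \<Sigma> S n)"
proof -
  have "sets (stat_algebra \<Sigma> S n) \<subseteq> sets P"
    unfolding stat_algebra_def assms(2)
    by (rule sets_image_in_sets[OF refl measurable_statistic_seq[OF assms(1)]])
  then show ?thesis
    using sets_eq_imp_space_eq[OF assms(2)] by (simp add: subalgebra_def stat_algebra_def)
qed

lemma integral_common_rcd:
  assumes "statistical_model \<P>" "statistics \<Sigma> S" "common_rcd \<P> \<Sigma> S n \<kappa>"
    and "P \<in> \<P>" "B \<in> sets (obs_space n)"
  shows "(\<integral>\<omega>. measure (\<kappa> (S n (first n \<omega>))) B \<partial>P) = measure P (first n -` B \<inter> space P)"
proof -
  from assms(1,4) have "prob_space P" and sets: "sets P = sets seq_space"
    by (auto simp: statistical_model_def space_prob_algebra)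
  interpret prob_space P by fact
  have sub: "subalgebra P (stat_algebra \<Sigma> S n)"
    using assms(2) sets by (rule subalgebra_stat_algebra)
  interpret finite_measure_subalgebra P "stat_algebra \<Sigma> S n"
    by unfold_locales (rule sub)
  have B: "first n -` B \<inter> space P \<in> sets P"
    using measurable_sets[OF measurable_first_seq assms(5)] sets sets_eq_imp_space_eq[OF sets]
    by simp
  have "(\<integral>\<omega>. measure (\<kappa> (S n (first n \<omega>))) B \<partial>P) =
      (\<integral>\<omega>. cprob P (stat_algebra \<Sigma> S n) (first n -` B \<inter> space P) \<omega> \<partial>P)"
  proof (rule integral_cong_AE)
    have "\<kappa> \<in> \<Sigma> n \<rightarrow>\<^sub>M subprob_algebra (obs_space n)"
      using assms(3) measurable_prob_algebraD by (auto simp: common_rcd_def)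
    moreover have "(\<lambda>\<omega>. S n (first n \<omega>)) \<in> P \<rightarrow>\<^sub>M \<Sigma> n"
      unfolding measurable_cong_sets[OF sets refl]
      using assms(2) by (rule measurable_statistic_seq)
    ultimately show "(\<lambda>\<omega>. measure (\<kappa> (S n (first n \<omega>))) B) \<in> borel_measurable P"
      using assms(5) by measurable
    show "cprob P (stat_algebra \<Sigma> S n) (first n -` B \<inter> space P) \<in> borel_measurable P"
      unfolding cprob_def by (rule borel_measurable_cond_exp2)
    show "AE \<omega> in P. measure (\<kappa> (S n (first n \<omega>))) B =
        cprob P (stat_algebra \<Sigma> S n) (first n -` B \<inter> space P) \<omega>"
      using assms(3-5) by (simp add: common_rcd_def)
  qed
  also have "\<dots> = (\<integral>\<omega>. indicator (first n -` B \<inter> space P) \<omega> \<partial>P)"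
    unfolding cprob_def using B by (intro real_cond_exp_int) (auto simp: emeasure_eq_measure)
  also have "\<dots> = measure P (first n -` B \<inter> space P)"
    using B by simp
  finally show ?thesis .
qed

text \<open>
  Apply bounded completeness to the conditional probability of \<open>B\<close> minus \<open>c\<close>; this is a legitimate
  test function since the kernel \<open>\<kappa>\<close> does not depend on \<open>P\<close>.
\<close>

lemma boundedly_complete_cond_prob:
  assumes "statistical_model \<P>" "statistics \<Sigma> S" "common_rcd \<P> \<Sigma> S n \<kappa>"
    and "boundedly_complete \<P> \<Sigma> S n" "B \<in> sets (obs_space n)"
    and "\<And>P. P \<in> \<P> \<Longrightarrow> measure P (first n -` B \<inter> space P) = c"
    and "P \<in> \<P>"
  shows "AE \<omega> in P. measure (\<kappa> (S n (first n \<omega>))) B = c"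
proof -
  let ?f = "\<lambda>s. measure (\<kappa> s) B - c"
  have \<kappa>: "\<kappa> \<in> \<Sigma> n \<rightarrow>\<^sub>M prob_algebra (obs_space n)"
    using assms(3) by (simp add: common_rcd_def)
  have meas: "(\<lambda>s. measure (\<kappa> s) B) \<in> borel_measurable (\<Sigma> n)"
    using measurable_prob_algebraD[OF \<kappa>] assms(5) by measurable
  have bdd: "bounded (?f ` space (\<Sigma> n))"
  proof (rule boundedI)
    fix r assume "r \<in> ?f ` space (\<Sigma> n)"
    then obtain s where s: "s \<in> space (\<Sigma> n)" "r = measure (\<kappa> s) B - c" by blast
    have "prob_space (\<kappa> s)"
      using measurable_space[OF \<kappa> s(1)] by (simp add: space_prob_algebra)
    then have "measure (\<kappa> s) B \<le> 1" by (rule prob_space.prob_le_1)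
    then show "norm r \<le> 1 + \<bar>c\<bar>"
      using s(2) measure_nonneg[of "\<kappa> s" B] unfolding real_norm_def by linarith
  qed
  have "(\<integral>\<omega>. ?f (S n (first n \<omega>)) \<partial>Q) = 0" if Q: "Q \<in> \<P>" for Q
  proof -
    from assms(1) Q have "prob_space Q" and sets: "sets Q = sets seq_space"
      by (auto simp: statistical_model_def space_prob_algebra)
    interpret prob_space Q by fact
    have S: "(\<lambda>\<omega>. S n (first n \<omega>)) \<in> Q \<rightarrow>\<^sub>M \<Sigma> n"
      unfolding measurable_cong_sets[OF sets refl]
      using assms(2) by (rule measurable_statistic_seq)
    have "integrable Q (\<lambda>\<omega>. measure (\<kappa> (S n (first n \<omega>))) B)"
    proof (rule integrable_const_bound[of _ 1])
      show "AE \<omega> in Q. norm (measure (\<kappa> (S n (first n \<omega>))) B) \<le> 1"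
        using measurable_space[OF \<kappa> measurable_space[OF S]]
        by (intro AE_I2) (auto simp: space_prob_algebra intro: prob_space.prob_le_1)
    qed (rule measurable_compose[OF S meas])
    then show ?thesis
      using integral_common_rcd[OF assms(1-3) Q assms(5)] assms(6)[OF Q]
      by (simp add: prob_space)
  qed
  moreover have "?f \<in> borel_measurable (\<Sigma> n)"
    using meas by measurable
  ultimately have "AE \<omega> in P. ?f (S n (first n \<omega>)) = 0"
    using assms(4,7) bdd unfolding boundedly_complete_def by meson
  then show ?thesis by simp
qed

text \<open>Conditional distributions are determined only up to null sets of the statistic.\<close>

lemma common_rcd_modify:
  fixes \<P> :: "(nat \<Rightarrow> 'k::finite observation) measure set"
  assumes "common_rcd \<P> \<Sigma> S n \<kappa>" "D \<in> sets (\<Sigma> n)"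
    and "\<And>P. P \<in> \<P> \<Longrightarrow> AE \<omega> in P. S n (first n \<omega>) \<in> D"
    and "\<mu> \<in> space (prob_algebra (obs_space n))"
  shows "common_rcd \<P> \<Sigma> S n (\<lambda>s. if s \<in> D then \<kappa> s else \<mu>)"
  unfolding common_rcd_def
proof (intro conjI ballI)
  show "(\<lambda>s. if s \<in> D then \<kappa> s else \<mu>) \<in> \<Sigma> n \<rightarrow>\<^sub>M prob_algebra (obs_space n)"
    using assms(1,2,4) by (intro measurable_If_set) (auto simp: common_rcd_def)
next
  fix P and B :: "(nat \<Rightarrow> 'k observation) set"
  assume P: "P \<in> \<P>" and B: "B \<in> sets (obs_space n)"
  from assms(1) P B have "AE \<omega> in P. measure (\<kappa> (S n (first n \<omega>))) B =
      cprob P (stat_algebra \<Sigma> S n) (first n -` B \<inter> space P) \<omega>"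
    by (simp add: common_rcd_def)
  with assms(3)[OF P] show "AE \<omega> in P. measure (if S n (first n \<omega>) \<in> D then \<kappa> (S n (first n \<omega>)) else \<mu>) B =
      cprob P (stat_algebra \<Sigma> S n) (first n -` B \<inter> space P) \<omega>"
    by eventually_elim simp
qed

text \<open>
  Almost surely the value of \<open>S n\<close> lies in the set \<open>D\<close> where all rational error levels are exact. As
  \<open>\<P>\<close> is nonempty, so is \<open>D\<close>, and the kernel at one point of \<open>D\<close> serves as its value
  off \<open>D\<close>. This makes the levels exact at every value of the statistic.
\<close>

lemma common_rcd_with_exact_error_levels:
  assumes model: "statistical_model \<P>" "\<P> \<noteq> {}" and S: "statistics \<Sigma> S"
    and "sufficient \<P> \<Sigma> S n" "boundedly_complete \<P> \<Sigma> S n"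
    and \<Gamma>: "confidence_predictor \<Gamma>" "weakly_valid \<P> \<N> \<Gamma>" and n: "n \<in> \<N>" "n \<ge> 1"
  shows "\<exists>\<kappa>. common_rcd \<P> \<Sigma> S n \<kappa> \<and> (\<forall>s\<in>space (\<Sigma> n). \<forall>q\<in>\<rat> \<inter> {0<..<1}.
    measure (\<kappa> s) {\<zeta> \<in> space (obs_space n). \<not> covers \<Gamma> n q \<zeta>} = q)"
proof -
  obtain \<kappa> where \<kappa>: "common_rcd \<P> \<Sigma> S n \<kappa>"
    using assms(4) by (auto simp: sufficient_def)
  then have \<kappa>_meas: "\<kappa> \<in> \<Sigma> n \<rightarrow>\<^sub>M prob_algebra (obs_space n)"
    by (simp add: common_rcd_def)
  define B where "B q = {\<zeta> \<in> space (obs_space n). \<not> covers \<Gamma> n q \<zeta>}" for q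
  have B: "B q \<in> sets (obs_space n)" if "q \<in> \<rat> \<inter> {0<..<1}" for q
  proof -
    have "B q = space (obs_space n) - {\<zeta> \<in> space (obs_space n). covers \<Gamma> n q \<zeta>}"
      by (auto simp: B_def)
    then show ?thesis using sets_covers[OF \<Gamma>(1) n(2), of q] that by auto
  qed
  have PB: "measure P (first n -` B q \<inter> space P) = q" if "P \<in> \<P>" "q \<in> \<rat> \<inter> {0<..<1}" for P q
  proof -
    have "first n -` B q \<inter> space P = {\<omega> \<in> space P. \<not> covers \<Gamma> n q \<omega>}"
      using covers_first[OF n(2)] first_in_obs_space by (auto simp: B_def)
    then show ?thesis using \<Gamma>(2) n(1) that by (auto simp: weakly_valid_def)
  qed
  define D where "D = {s \<in> space (\<Sigma> n). \<forall>q\<in>\<rat> \<inter> {0<..<1}. measure (\<kappa> s) (B q) = q}"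
  have count: "countable (\<rat> \<inter> {0<..<1::real})"
    using countable_rat by (rule countable_Int1)
  have D_sets: "D \<in> sets (\<Sigma> n)"
    unfolding D_def
  proof (rule sets.sets_Collect_countable_All'[OF _ count])
    fix q :: real assume "q \<in> \<rat> \<inter> {0<..<1}"
    from B[OF this] have "(\<lambda>s. measure (\<kappa> s) (B q)) \<in> borel_measurable (\<Sigma> n)"
      using measurable_prob_algebraD[OF \<kappa>_meas] by measurable
    then show "{s \<in> space (\<Sigma> n). measure (\<kappa> s) (B q) = q} \<in> sets (\<Sigma> n)" by measurable
  qed
  have D_AE: "AE \<omega> in P. S n (first n \<omega>) \<in> D" if P: "P \<in> \<P>" for P
  proof -
    have "AE \<omega> in P. \<forall>q\<in>\<rat> \<inter> {0<..<1}. measure (\<kappa> (S n (first n \<omega>))) (B q) = q"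
      unfolding AE_ball_countable[OF count]
      using boundedly_complete_cond_prob[OF model(1) S \<kappa> assms(5) B PB P] by blast
    moreover have "S n (first n \<omega>) \<in> space (\<Sigma> n)" for \<omega>
      by (rule measurable_space[OF measurable_statistic[OF S] first_in_obs_space])
    ultimately show ?thesis by (simp add: D_def)
  qed
  obtain s where s: "s \<in> D"
  proof -
    obtain P where P: "P \<in> \<P>" using model(2) by blast
    with model(1) interpret prob_space P
      by (auto simp: statistical_model_def space_prob_algebra)
    have "\<exists>\<omega>. S n (first n \<omega>) \<in> D"
      using D_AE[OF P] by (auto dest: eventually_happens simp: trivial_limit_def AE_False)
    then show thesis using that by blast
  qed
  then have "\<kappa> s \<in> space (prob_algebra (obs_space n))"
    using measurable_space[OF \<kappa>_meas] by (auto simp: D_def)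
  with common_rcd_modify[OF \<kappa> D_sets D_AE] s show ?thesis
    by (intro exI[of _ "\<lambda>t. if t \<in> D then \<kappa> t else \<kappa> s"]) (auto simp: D_def B_def)
qed

section \<open>Conformal predictors\<close>

lemma borel_measurable_p_value:
  assumes S: "statistics \<Sigma> S" and A: "nonconformity_measure \<Sigma> A" and n: "n \<ge> 1"
    and \<kappa>: "\<kappa> n \<in> \<Sigma> n \<rightarrow>\<^sub>M prob_algebra (obs_space n)"
  shows "p_value S \<kappa> A n \<in> borel_measurable (obs_space n)"
proof -
  note [measurable] = measurable_statistic[OF S]
  have [measurable]: "A n \<in> borel_measurable (\<Sigma> (n - 1) \<Otimes>\<^sub>M borel)"
    using A n by (simp add: nonconformity_measure_def)
  have [measurable]: "first (n - 1) \<in> obs_space n \<rightarrow>\<^sub>M obs_space (n - 1)"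
    by (rule measurable_first) simp
  have [measurable]: "(\<lambda>\<zeta>. \<zeta> n) \<in> obs_space n \<rightarrow>\<^sub>M borel"
    unfolding obs_space_def using n by (intro measurable_component_singleton) auto
  have score [measurable]: "nonconformity_score S A n \<in> borel_measurable (obs_space n)"
    unfolding nonconformity_score_def by measurable
  show ?thesis
    unfolding p_value_def
  proof (rule measure_measurable_subprob_algebra2)
    have "{w \<in> space (obs_space n \<Otimes>\<^sub>M obs_space n).
        nonconformity_score S A n (fst w) \<le> nonconformity_score S A n (snd w)}
        \<in> sets (obs_space n \<Otimes>\<^sub>M obs_space n)"
      by measurable
    also have "{w \<in> space (obs_space n \<Otimes>\<^sub>M obs_space n).
        nonconformity_score S A n (fst w) \<le> nonconformity_score S A n (snd w)} =
      (SIGMA \<zeta>:space (obs_space n). {\<xi> \<in> space (obs_space n).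
        nonconformity_score S A n \<zeta> \<le> nonconformity_score S A n \<xi>})"
      by (auto simp: space_pair_measure)
    finally show "\<dots> \<in> sets (obs_space n \<Otimes>\<^sub>M obs_space n)" .
    show "(\<lambda>\<zeta>. \<kappa> n (S n \<zeta>)) \<in> obs_space n \<rightarrow>\<^sub>M subprob_algebra (obs_space n)"
      using measurable_prob_algebraD[OF \<kappa>] by measurable
  qed
qed

lemma conformal_predictor_of_nonconformity_measure:
  assumes S: "statistics \<Sigma> S" and A: "nonconformity_measure \<Sigma> A"
    and \<kappa>: "\<And>n. n \<ge> 1 \<Longrightarrow> \<kappa> n \<in> \<Sigma> n \<rightarrow>\<^sub>M prob_algebra (obs_space n)"
  shows "conformal_predictor \<Sigma> S \<kappa> (\<lambda>n \<epsilon> past x. {y. p_value S \<kappa> A n (past(n := (x, y))) > \<epsilon>})"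
    (is "conformal_predictor \<Sigma> S \<kappa> ?\<Gamma>")
proof -
  have "confidence_predictor ?\<Gamma>"
    unfolding confidence_predictor_def
  proof (intro allI impI conjI ballI)
    fix n :: nat assume n: "n \<ge> 1"
    note [measurable] = borel_measurable_p_value[OF S A n, of \<kappa>, OF \<kappa>[OF n]]
    have covers: "covers ?\<Gamma> n \<epsilon> \<zeta> \<longleftrightarrow> \<epsilon> < p_value S \<kappa> A n \<zeta>"
      if "\<zeta> \<in> space (obs_space n)" for \<epsilon> \<zeta>
      unfolding covers_def mem_Collect_eq prod.collapse first_upd_last[OF n that] ..
    have "{w \<in> space (borel \<Otimes>\<^sub>M obs_space n).
        fst w \<in> {0<..<1} \<and> fst w < p_value S \<kappa> A n (snd w)} \<in> sets (borel \<Otimes>\<^sub>M obs_space n)"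
      by measurable
    also have "{w \<in> space (borel \<Otimes>\<^sub>M obs_space n).
        fst w \<in> {0<..<1} \<and> fst w < p_value S \<kappa> A n (snd w)} =
      {(\<epsilon>, \<zeta>). \<epsilon> \<in> {0<..<1} \<and> \<zeta> \<in> space (obs_space n) \<and> covers ?\<Gamma> n \<epsilon> \<zeta>}"
      by (auto simp: space_pair_measure covers)
    finally show "\<dots> \<in> sets (borel \<Otimes>\<^sub>M obs_space n)" .
  qed auto
  with A show ?thesis
    unfolding conformal_predictor_def by blast
qed

text \<open>
  A p-value is the distribution function of the critical level evaluated at the observed critical
  level, so it inherits the bound by the uniform distribution function.
\<close>

lemma p_value_le_critical_level:
  assumes \<Gamma>: "confidence_predictor \<Gamma>" and n: "n \<ge> 1"
    and \<kappa>: "\<kappa> n (S n \<zeta>) \<in> space (prob_algebra (obs_space n))"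
    and size: "\<And>q. q \<in> \<rat> \<inter> {0<..<1} \<Longrightarrow>
      measure (\<kappa> n (S n \<zeta>)) {\<xi> \<in> space (obs_space n). \<not> covers \<Gamma> n q \<xi>} = q"
    and A: "\<And>\<xi>. nonconformity_score S A n \<xi> = - critical_level (\<lambda>\<epsilon>. covers \<Gamma> n \<epsilon> \<xi>)"
  shows "p_value S \<kappa> A n \<zeta> \<le> critical_level (\<lambda>\<epsilon>. covers \<Gamma> n \<epsilon> \<zeta>)"
proof -
  from \<kappa> have prob: "prob_space (\<kappa> n (S n \<zeta>))" and sets: "sets (\<kappa> n (S n \<zeta>)) = sets (obs_space n)"
    by (auto simp: space_prob_algebra)
  note space = sets_eq_imp_space_eq[OF sets]
  have "measure (\<kappa> n (S n \<zeta>)) {\<xi> \<in> space (\<kappa> n (S n \<zeta>)).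
      critical_level (\<lambda>\<epsilon>. covers \<Gamma> n \<epsilon> \<xi>) \<le> critical_level (\<lambda>\<epsilon>. covers \<Gamma> n \<epsilon> \<zeta>)}
      \<le> critical_level (\<lambda>\<epsilon>. covers \<Gamma> n \<epsilon> \<zeta>)"
    using sets_covers[OF \<Gamma> n] size
    by (intro measure_critical_level_le[OF prob] critical_level_nonneg) (auto simp: sets space)
  then show ?thesis
    by (simp add: p_value_def A space)
qed

theorem theorem2:
  fixes \<P> :: "(nat \<Rightarrow> 'k::finite observation) measure set"
    and \<Sigma> :: "nat \<Rightarrow> 's measure"
    and S :: "nat \<Rightarrow> (nat \<Rightarrow> 'k observation) \<Rightarrow> 's"
    and \<N> :: "nat set"
    and \<Gamma> :: "'k predictor"
  assumes "statistical_model \<P>"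
    and "ATTS \<P> \<Sigma> S"
    and "\<forall>n\<in>\<N>. n \<ge> 1"
    and "\<forall>n\<in>\<N>. boundedly_complete \<P> \<Sigma> S n"
    and "confidence_predictor \<Gamma>"
    and "invariant \<Sigma> S \<Gamma>"
    and "weakly_valid \<P> \<N> \<Gamma>"
  shows "\<exists>\<kappa> \<Gamma>'. (\<forall>n\<ge>1. common_rcd \<P> \<Sigma> S n (\<kappa> n)) \<and>
           conformal_predictor \<Sigma> S \<kappa> \<Gamma>' \<and>
           at_least_as_accurate \<P> \<N> \<Gamma>' \<Gamma>"
proof -
  have S: "statistics \<Sigma> S" and suff: "\<And>n. n \<ge> 1 \<Longrightarrow> sufficient \<P> \<Sigma> S n"
    using assms(2) unfolding ATTS_def totally_sufficient_def by blast+
  have "\<exists>\<kappa>. \<forall>n. n \<ge> 1 \<longrightarrow> common_rcd \<P> \<Sigma> S n (\<kappa> n) \<and>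
    (\<P> \<noteq> {} \<longrightarrow> n \<in> \<N> \<longrightarrow> (\<forall>s\<in>space (\<Sigma> n). \<forall>q\<in>\<rat> \<inter> {0<..<1}.
      measure (\<kappa> n s) {\<zeta> \<in> space (obs_space n). \<not> covers \<Gamma> n q \<zeta>} = q))"
  proof (rule choice, rule allI)
    fix n
    \<comment> \<open>If \<open>\<P>\<close> is empty, no exact version need exist, but accuracy is then vacuous.\<close>
    consider "n \<ge> 1" "\<P> \<noteq> {}" "n \<in> \<N>" | "n \<ge> 1" "\<P> = {} \<or> n \<notin> \<N>" | "\<not> n \<ge> 1" by blast
    then show "\<exists>\<kappa>. n \<ge> 1 \<longrightarrow> common_rcd \<P> \<Sigma> S n \<kappa> \<and>
      (\<P> \<noteq> {} \<longrightarrow> n \<in> \<N> \<longrightarrow> (\<forall>s\<in>space (\<Sigma> n). \<forall>q\<in>\<rat> \<inter> {0<..<1}.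
        measure (\<kappa> s) {\<zeta> \<in> space (obs_space n). \<not> covers \<Gamma> n q \<zeta>} = q))"
    proof cases
      case 1
      then have "boundedly_complete \<P> \<Sigma> S n" using assms(4) by blast
      from common_rcd_with_exact_error_levels[OF assms(1) 1(2) S suff[OF 1(1)] this assms(5,7) 1(3,1)]
      show ?thesis by (elim ex_forward) simp
    next
      case 2
      from suff[OF 2(1)] obtain \<kappa> where "common_rcd \<P> \<Sigma> S n \<kappa>"
        unfolding sufficient_def ..
      with 2(2) show ?thesis by (intro exI[of _ \<kappa>]) blast
    next
      case 3
      then show ?thesis by (intro exI[of _ undefined]) (rule impI, rule notE)
    qed
  qed
  then obtain \<kappa> where \<kappa>_props: "\<forall>n. n \<ge> 1 \<longrightarrow> common_rcd \<P> \<Sigma> S n (\<kappa> n) \<and>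
    (\<P> \<noteq> {} \<longrightarrow> n \<in> \<N> \<longrightarrow> (\<forall>s\<in>space (\<Sigma> n). \<forall>q\<in>\<rat> \<inter> {0<..<1}.
      measure (\<kappa> n s) {\<zeta> \<in> space (obs_space n). \<not> covers \<Gamma> n q \<zeta>} = q))" ..
  then have \<kappa>: "\<And>n. n \<ge> 1 \<Longrightarrow> common_rcd \<P> \<Sigma> S n (\<kappa> n)" by simp
  have size: "measure (\<kappa> n s) {\<zeta> \<in> space (obs_space n). \<not> covers \<Gamma> n q \<zeta>} = q"
    if "n \<ge> 1" "\<P> \<noteq> {}" "n \<in> \<N>" "s \<in> space (\<Sigma> n)" "q \<in> \<rat> \<inter> {0<..<1}" for n s q
    using \<kappa>_props that by blast
  have \<kappa>_meas: "\<kappa> n \<in> \<Sigma> n \<rightarrow>\<^sub>M prob_algebra (obs_space n)" if "n \<ge> 1" for n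
    using \<kappa>[OF that] by (simp add: common_rcd_def)
  obtain A where A: "nonconformity_measure \<Sigma> A"
    and score: "\<And>n \<zeta>. n \<ge> 1 \<Longrightarrow>
      nonconformity_score S A n \<zeta> = - critical_level (\<lambda>\<epsilon>. covers \<Gamma> n \<epsilon> \<zeta>)"
    using invariant_critical_level_factors[OF assms(5,6)] by blast
  define \<Gamma>' where "\<Gamma>' = (\<lambda>n \<epsilon> past x. {y. p_value S \<kappa> A n (past(n := (x, y))) > \<epsilon>})"
  have subset: "\<Gamma>' n \<epsilon> past x \<subseteq> \<Gamma> n \<epsilon> past x"
    if "\<P> \<noteq> {}" "n \<in> \<N>" and \<epsilon>: "\<epsilon> \<in> {0<..<1}" and past: "past \<in> space (obs_space (n - 1))"
    for n \<epsilon> past x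
  proof
    fix y assume y: "y \<in> \<Gamma>' n \<epsilon> past x"
    have n: "n \<ge> 1" using assms(3) that(2) by blast
    let ?\<zeta> = "past(n := (x, y))"
    note upd = past_upd_obs[OF n past, of "(x, y)"]
    have s: "S n ?\<zeta> \<in> space (\<Sigma> n)"
      by (rule measurable_space[OF measurable_statistic[OF S] upd(1)])
    have "\<epsilon> < p_value S \<kappa> A n ?\<zeta>"
      using y by (simp add: \<Gamma>'_def)
    also have "\<dots> \<le> critical_level (\<lambda>\<epsilon>. covers \<Gamma> n \<epsilon> ?\<zeta>)"
      by (rule p_value_le_critical_level[where n = n and \<kappa> = \<kappa> and S = S and A = A,
            OF assms(5) n measurable_space[OF \<kappa>_meas[OF n] s] size[OF n that(1,2) s] score[OF n]])
    finally have less: "\<epsilon> < critical_level (\<lambda>\<epsilon>. covers \<Gamma> n \<epsilon> ?\<zeta>)" .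
    have "0 \<le> \<epsilon>" using \<epsilon> by simp
    from this less obtain q where q: "q \<in> \<rat> \<inter> {0<..<1}" "\<epsilon> < q" "covers \<Gamma> n q ?\<zeta>"
      by (rule less_critical_levelD)
    from q(3) have "y \<in> \<Gamma> n q past x"
      unfolding covers_def upd(2) by simp
    with confidence_predictor_mono[OF assms(5) n past \<epsilon> _ q(2)] q(1) show "y \<in> \<Gamma> n \<epsilon> past x"
      by blast
  qed
  have "at_least_as_accurate \<P> \<N> \<Gamma>' \<Gamma>"
    unfolding at_least_as_accurate_def
  proof (intro ballI AE_I2)
    fix P \<epsilon> n w
    assume P: "P \<in> \<P>" and \<epsilon>: "\<epsilon> \<in> {0<..<1::real}" and n: "n \<in> \<N>"
      and w: "w \<in> space (distr P (obs_space (n - 1) \<Otimes>\<^sub>M borel)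
        (\<lambda>\<omega>. (first (n - 1) \<omega>, fst (\<omega> n))))"
    obtain past x where px: "w = (past, x)" by (cases w)
    with w have past: "past \<in> space (obs_space (n - 1))"
      by (simp add: space_pair_measure)
    from P have "\<P> \<noteq> {}" by blast
    from subset[OF this n \<epsilon> past]
    show "case w of (past, x) \<Rightarrow> \<Gamma>' n \<epsilon> past x \<subseteq> \<Gamma> n \<epsilon> past x"
      unfolding px by simp
  qed
  moreover have "conformal_predictor \<Sigma> S \<kappa> \<Gamma>'"
    unfolding \<Gamma>'_def by (rule conformal_predictor_of_nonconformity_measure[OF S A \<kappa>_meas])
  ultimately show ?thesis
    using \<kappa> by (intro exI[of _ \<kappa>] exI[of _ \<Gamma>'] conjI allI impI)
qed

end
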